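(* Let $P$ be a substochastic $K\times K$ matrix with spectral radius less than $1$, and let $C=(c_{ml})=(I-P^T)^{-1}$. Then $c_{ml}\le c_{mm}$ for all $m,l\in\{1,\dots,K\}$.
   Context: Substochastic: nonnegative entries, row sums at most $1$. *)

theory Defs
  imports "Jordan_Normal_Form.Spectral_Radius" "Jordan_Normal_Form.Gauss_Jordan_Elimination"
begin

definition substochastic_mat :: "nat \<Rightarrow> real mat \<Rightarrow> bool" where
  "substochastic_mat K P \<longleftrightarrow>
     P \<in> carrier_mat K K \<and>
     (\<forall>i<K. \<forall>j<K. 0 \<le> P $$ (i, j)) \<and>
     (\<forall>i<K. (\<Sum>j<K. P $$ (i, j)) \<le> 1)"

end

(* Everything follows from a maximum principle: for a nonnegative P of spectral radius below 1,
   z \<le> P z forces z \<le> 0, since z \<le> P^k z and P^k tends to 0. Applied to v and -v for a fixed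
   vector v = P v it shows that I - P^T is invertible. A row x = (c_{ml})_l of the inverse satisfies
   x = P x + e_m; applied to -x the principle gives x \<ge> 0, and as the row sums of P are at most 1,
   the positive part y of x - x_m satisfies y \<le> P y, so that x \<le> x_m. *)
theory Submission
  imports Defs
begin

lemma mult_mat_vec_nth:
  assumes "A \<in> carrier_mat nr n" "v \<in> carrier_vec n" "i < nr"
  shows "(A *\<^sub>v v) $ i = (\<Sum>j<n. A $$ (i, j) * v $ j)"
  using assms by (auto simp: scalar_prod_def lessThan_atLeast0 intro!: sum.cong)

text \<open>An eigenvector of \<open>c A\<close> for \<open>k\<close> is an eigenvector of
  \<open>A\<close> for \<open>k / c\<close>, so the eigenvalue of \<open>c A\<close> of largest
  modulus is at most \<open>c\<close> times the spectral radius of \<open>A\<close> in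
  modulus.\<close>

lemma spectral_radius_smult_less_1:
  fixes A :: "complex mat"
  assumes A: "A \<in> carrier_mat n n" and n: "n > 0" and c: "c > 0"
    and sr: "c * spectral_radius A < 1"
  shows "spectral_radius (of_real c \<cdot>\<^sub>m A) < 1"
proof -
  let ?B = "of_real c \<cdot>\<^sub>m A"
  have B: "?B \<in> carrier_mat n n" using A by simp
  obtain k where k: "k \<in> spectrum ?B" "spectral_radius ?B = norm k"
    using spectral_radius_mem_max(1)[OF B n] by auto
  then obtain v where v: "v \<in> carrier_vec n" "v \<noteq> 0\<^sub>v n" "?B *\<^sub>v v = k \<cdot>\<^sub>v v"
    using A unfolding spectrum_def eigenvalue_def eigenvector_def by auto
  have "A *\<^sub>v v = (k / of_real c) \<cdot>\<^sub>v v"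
  proof (rule eq_vecI)
    fix i assume "i < dim_vec ((k / of_real c) \<cdot>\<^sub>v v)"
    then have i: "i < n" using v by simp
    have "(?B *\<^sub>v v) $ i = of_real c * (A *\<^sub>v v) $ i"
      using i A v(1) by (auto simp: scalar_prod_def sum_distrib_left mult.assoc)
    then have "of_real c * (A *\<^sub>v v) $ i = k * v $ i"
      using v i by simp
    then show "(A *\<^sub>v v) $ i = ((k / of_real c) \<cdot>\<^sub>v v) $ i"
      using i v(1) c by (simp add: field_simps)
  qed (use A v in auto)
  then have "k / of_real c \<in> spectrum A"
    using A v unfolding spectrum_def eigenvalue_def eigenvector_def by auto
  then have "norm (k / of_real c) \<le> spectral_radius A"
    using spectral_radius_mem_max(2)[OF A n] by blast
  then have "norm k \<le> c * spectral_radius A"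
    using c by (simp add: norm_divide field_simps)
  then show ?thesis using k sr by simp
qed

lemma pow_mat_nonneg:
  fixes A :: "real mat"
  assumes A: "A \<in> carrier_mat n n" and nn: "\<And>i j. i < n \<Longrightarrow> j < n \<Longrightarrow> 0 \<le> A $$ (i, j)"
  shows "i < n \<Longrightarrow> j < n \<Longrightarrow> 0 \<le> (A ^\<^sub>m k) $$ (i, j)"
proof (induction k arbitrary: i j)
  case 0
  then show ?case using A by (simp add: one_mat_def)
next
  case (Suc k)
  then show ?case using A nn
    by (auto simp: scalar_prod_def intro!: sum_nonneg mult_nonneg_nonneg)
qed

text \<open>Powers of a nonnegative matrix preserve entrywise inequalities, so applying
  \<open>A ^\<^sub>m k\<close> to the hypothesis on \<open>z\<close> gains one more factor
  \<open>c\<close> at each induction step.\<close>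

lemma subinvariant_pow_le:
  fixes A :: "real mat"
  assumes A: "A \<in> carrier_mat n n" and nn: "\<And>i j. i < n \<Longrightarrow> j < n \<Longrightarrow> 0 \<le> A $$ (i, j)"
    and c: "c \<ge> 0"
    and z: "z \<in> carrier_vec n" "\<And>i. i < n \<Longrightarrow> c * z $ i \<le> (A *\<^sub>v z) $ i"
    and i: "i < n"
  shows "c ^ k * z $ i \<le> (A ^\<^sub>m k *\<^sub>v z) $ i"
proof (induction k)
  case 0
  then show ?case using A z i by simp
next
  case (Suc k)
  have Ak: "A ^\<^sub>m k \<in> carrier_mat n n" using A by simp
  have mv: "(A ^\<^sub>m k *\<^sub>v w) $ i = (\<Sum>j<n. (A ^\<^sub>m k) $$ (i, j) * w $ j)" if "w \<in> carrier_vec n" for w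
    using mult_mat_vec_nth[OF Ak that i] .
  have "c ^ Suc k * z $ i \<le> c * (A ^\<^sub>m k *\<^sub>v z) $ i"
    using mult_left_mono[OF Suc.IH c] by (simp add: mult.assoc)
  also have "\<dots> = (\<Sum>j<n. (A ^\<^sub>m k) $$ (i, j) * (c * z $ j))"
    unfolding mv[OF z(1)] by (simp add: sum_distrib_left mult_ac)
  also have "\<dots> \<le> (\<Sum>j<n. (A ^\<^sub>m k) $$ (i, j) * (A *\<^sub>v z) $ j)"
    using z i by (intro sum_mono mult_left_mono pow_mat_nonneg[OF A nn]) auto
  also have "\<dots> = (A ^\<^sub>m k *\<^sub>v (A *\<^sub>v z)) $ i"
    by (rule mv[symmetric]) (use A z in auto)
  also have "A ^\<^sub>m k *\<^sub>v (A *\<^sub>v z) = A ^\<^sub>m Suc k *\<^sub>v z"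
    using assoc_mult_mat_vec[OF Ak A z(1)] by simp
  finally show ?case .
qed

text \<open>The maximum principle. With \<open>A = c P\<close> and \<open>c > 1\<close>,
  \<open>c ^ k * z i\<close> is at most an entry of \<open>A ^\<^sub>m k\<close> applied to
  \<open>z\<close>, which stays bounded in \<open>k\<close>; a positive \<open>z i\<close> would
  make the left side unbounded.\<close>

lemma subinvariant_nonpos:
  fixes P :: "real mat"
  assumes P: "P \<in> carrier_mat n n" and nn: "\<And>i j. i < n \<Longrightarrow> j < n \<Longrightarrow> 0 \<le> P $$ (i, j)"
    and sr: "spectral_radius (map_mat complex_of_real P) < 1"
    and z: "\<And>i. i < n \<Longrightarrow> z i \<le> (\<Sum>j<n. P $$ (i, j) * z j)"
    and i: "i < n"
  shows "z i \<le> 0"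
proof -
  let ?P = "map_mat complex_of_real P"
  have n: "n > 0" using i by simp
  have P': "?P \<in> carrier_mat n n" using P by simp
  have sr0: "spectral_radius ?P \<ge> 0"
    using spectral_radius_mem_max(1)[OF P' n] by auto
  \<comment> \<open>The library only bounds the powers of a matrix of spectral radius below 1; scaling by
    some \<open>c > 1\<close> turns this bound into geometric decay.\<close>
  define c where "c = 2 / (1 + spectral_radius ?P)"
  \<comment> \<open>\<open>c\<close> is the reciprocal of the midpoint between the spectral radius
    and 1, and both inequalities reduce to the radius being below 1.\<close>
  have c1: "c > 1" and csr: "c * spectral_radius ?P < 1"
    using sr sr0 by (auto simp: c_def field_simps)
  define A where "A = c \<cdot>\<^sub>m P"
  have A: "A \<in> carrier_mat n n" using P by (simp add: A_def)
  have Ann: "0 \<le> A $$ (i, j)" if "i < n" "j < n" for i j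
    using that P nn c1 by (simp add: A_def)
  have mA: "map_mat complex_of_real A = of_real c \<cdot>\<^sub>m ?P"
    by (rule eq_matI) (auto simp: A_def)
  have "spectral_radius (map_mat complex_of_real A) < 1"
    unfolding mA using spectral_radius_smult_less_1[OF P' n _ csr] c1 by simp
  \<comment> \<open>\<open>norm_bound\<close> is an entrywise bound, and the same \<open>b\<close>
    serves for all powers \<open>k\<close>.\<close>
  then obtain b where b: "\<And>k. norm_bound (map_mat complex_of_real A ^\<^sub>m k) b"
    using spectral_radius_jnf_norm_bound_less_1_upper_triangular[of "map_mat complex_of_real A" n] A
    by auto
  have bnd: "\<bar>(A ^\<^sub>m k) $$ (i, j)\<bar> \<le> b" if "j < n" for j k
  proof -
    have "map_mat complex_of_real A ^\<^sub>m k = map_mat complex_of_real (A ^\<^sub>m k)"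
      using of_real_hom.mat_hom_pow[OF A] by metis
    then have "norm (complex_of_real ((A ^\<^sub>m k) $$ (i, j))) \<le> b"
      using b[of k] A i that unfolding norm_bound_def by auto
    then show ?thesis by simp
  qed
  define v where "v = vec n z"
  have v: "v \<in> carrier_vec n" by (simp add: v_def)
  have Av: "c * v $ j \<le> (A *\<^sub>v v) $ j" if "j < n" for j
  proof -
    have "(A *\<^sub>v v) $ j = c * (\<Sum>l<n. P $$ (j, l) * z l)"
      unfolding mult_mat_vec_nth[OF A v that] sum_distrib_left
      using that P by (intro sum.cong) (auto simp: A_def v_def)
    then show ?thesis using z[OF that] c1 that by (simp add: v_def)
  qed
  have le: "c ^ k * z i \<le> (\<Sum>j<n. b * \<bar>z j\<bar>)" for k
  proof -
    have "c ^ k * z i \<le> (A ^\<^sub>m k *\<^sub>v v) $ i"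
      using subinvariant_pow_le[OF A Ann _ v Av i, of k] c1 i by (simp add: v_def)
    also have "\<dots> = (\<Sum>j<n. (A ^\<^sub>m k) $$ (i, j) * z j)"
      unfolding mult_mat_vec_nth[OF pow_carrier_mat[OF A] v i] by (simp add: v_def)
    also have "\<dots> \<le> (\<Sum>j<n. b * \<bar>z j\<bar>)"
    proof (rule sum_mono)
      fix j assume "j \<in> {..<n}"
      then have "\<bar>(A ^\<^sub>m k) $$ (i, j)\<bar> * \<bar>z j\<bar> \<le> b * \<bar>z j\<bar>"
        using bnd by (intro mult_right_mono) auto
      then show "(A ^\<^sub>m k) $$ (i, j) * z j \<le> b * \<bar>z j\<bar>"
        using abs_ge_self[of "(A ^\<^sub>m k) $$ (i, j) * z j"] by (simp add: abs_mult)
    qed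
    finally show ?thesis .
  qed
  show ?thesis
  proof (rule ccontr)
    assume "\<not> z i \<le> 0"
    then have pos: "z i > 0" by simp
    obtain k where "(\<Sum>j<n. b * \<bar>z j\<bar>) / z i < c ^ k"
      using real_arch_pow[OF c1] by blast
    then have "(\<Sum>j<n. b * \<bar>z j\<bar>) < c ^ k * z i"
      using pos by (simp add: field_simps)
    then show False using le[of k] by simp
  qed
qed

text \<open>A kernel vector is a fixed vector of \<open>P\<close>, and the maximum principle bounds
  both it and its negative by 0. The matrix is left untransposed so that the hypotheses on
  \<open>P\<close> apply as they stand.\<close>

lemma det_one_minus_nonneg_mat:
  fixes P :: "real mat"
  assumes P: "P \<in> carrier_mat n n" and nn: "\<And>i j. i < n \<Longrightarrow> j < n \<Longrightarrow> 0 \<le> P $$ (i, j)"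
    and sr: "spectral_radius (map_mat complex_of_real P) < 1"
  shows "det (1\<^sub>m n - P) \<noteq> 0"
proof
  assume "det (1\<^sub>m n - P) = 0"
  moreover have "1\<^sub>m n - P \<in> carrier_mat n n" by (rule minus_carrier_mat[OF P])
  ultimately obtain v where v: "v \<in> carrier_vec n" "v \<noteq> 0\<^sub>v n" "(1\<^sub>m n - P) *\<^sub>v v = 0\<^sub>v n"
    using det_0_iff_vec_prod_zero_field by blast
  have fixed: "v $ i = (\<Sum>j<n. P $$ (i, j) * v $ j)" if i: "i < n" for i
  proof -
    have "(1\<^sub>m n - P) *\<^sub>v v = 1\<^sub>m n *\<^sub>v v - P *\<^sub>v v"
      using minus_mult_distrib_mat_vec[OF _ P v(1)] by simp
    then have "v - P *\<^sub>v v = 0\<^sub>v n" using v by simp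
    then have "(v - P *\<^sub>v v) $ i = 0" using i by simp
    then show ?thesis using mult_mat_vec_nth[OF P v(1) i] P v(1) i by simp
  qed
  have "v $ i = 0" if i: "i < n" for i
  proof (rule antisym)
    show "v $ i \<le> 0"
      by (rule subinvariant_nonpos[OF P nn sr eq_refl[OF fixed] i])
    have "- v $ i \<le> 0"
    proof (rule subinvariant_nonpos[OF P nn sr _ i])
      fix k assume "k < n"
      then show "- v $ k \<le> (\<Sum>j<n. P $$ (k, j) * - v $ j)"
        using fixed[of k] by (simp add: sum_negf)
    qed
    then show "0 \<le> v $ i" by simp
  qed
  then have "v = 0\<^sub>v n" using v(1) by (intro eq_vecI) auto
  then show False using v(2) by simp
qed

text \<open>The source term sits only at \<open>m\<close>, exactly where the positive part of
  \<open>x - x m\<close> vanishes, so this positive part is subinvariant under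
  \<open>P\<close>.\<close>

lemma substochastic_potential_max:
  assumes P: "substochastic_mat n P"
    and sr: "spectral_radius (map_mat complex_of_real P) < 1"
    and x: "\<And>i. i < n \<Longrightarrow> x i = (\<Sum>j<n. P $$ (i, j) * x j) + (if i = m then 1 else 0)"
    and m: "m < n" and l: "l < n"
  shows "x l \<le> x m"
proof -
  have PC: "P \<in> carrier_mat n n" and nn: "\<And>i j. i < n \<Longrightarrow> j < n \<Longrightarrow> 0 \<le> P $$ (i, j)"
    and row: "\<And>i. i < n \<Longrightarrow> (\<Sum>j<n. P $$ (i, j)) \<le> 1"
    using P unfolding substochastic_mat_def by auto
  have "- x m \<le> 0"
  proof (rule subinvariant_nonpos[OF PC nn sr _ m])
    fix i assume "i < n"
    then show "- x i \<le> (\<Sum>j<n. P $$ (i, j) * - x j)"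
      using x[of i] by (simp add: sum_negf)
  qed
  then have xm: "0 \<le> x m" by simp
  define y where "y i = max 0 (x i - x m)" for i
  have "y l \<le> 0"
  proof (rule subinvariant_nonpos[OF PC nn sr _ l])
    fix i assume i: "i < n"
    have nonneg: "0 \<le> (\<Sum>j<n. P $$ (i, j) * y j)"
      using nn i by (intro sum_nonneg mult_nonneg_nonneg) (auto simp: y_def)
    show "y i \<le> (\<Sum>j<n. P $$ (i, j) * y j)"
    proof (cases "i = m")
      case True
      then show ?thesis using nonneg by (simp add: y_def)
    next
      case False
      \<comment> \<open>This is where the sign of \<open>x m\<close> matters: with row sums possibly
        below 1, subtracting the constant \<open>x m\<close> keeps the inequality only for
        \<open>x m\<close> nonnegative.\<close>
      have "(\<Sum>j<n. P $$ (i, j)) * x m \<le> x m"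
        using mult_right_mono[OF row[OF i] xm] by simp
      then have "x i - x m \<le> (\<Sum>j<n. P $$ (i, j) * x j) - (\<Sum>j<n. P $$ (i, j)) * x m"
        using x[OF i] False by simp
      also have "\<dots> = (\<Sum>j<n. P $$ (i, j) * (x j - x m))"
        by (simp add: right_diff_distrib sum_subtractf sum_distrib_right)
      also have "\<dots> \<le> (\<Sum>j<n. P $$ (i, j) * y j)"
        using nn i by (intro sum_mono mult_left_mono) (auto simp: y_def)
      finally show ?thesis using nonneg by (simp add: y_def)
    qed
  qed auto
  then show ?thesis by (simp add: y_def)
qed

theorem mainTheorem7:
  fixes P :: "real mat" and K :: nat
  assumes "K \<ge> 1"
    and "substochastic_mat K P"
    and "spectral_radius (map_mat complex_of_real P) < 1"
  shows "\<exists>C. mat_inverse (1\<^sub>m K - transpose_mat P) = Some C \<and>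
             (\<forall>m<K. \<forall>l<K. C $$ (m, l) \<le> C $$ (m, m))"
proof -
  let ?D = "1\<^sub>m K - transpose_mat P"
  have P: "P \<in> carrier_mat K K" and nn: "\<And>i j. i < K \<Longrightarrow> j < K \<Longrightarrow> 0 \<le> P $$ (i, j)"
    using assms(2) unfolding substochastic_mat_def by auto
  have D: "?D \<in> carrier_mat K K"
    by (rule minus_carrier_mat) (use P in simp)
  have "transpose_mat (1\<^sub>m K - P) = ?D"
    using P by (intro eq_matI) auto
  \<comment> \<open>The determinant is invariant under transposition, which carries invertibility
    over to \<open>?D\<close>.\<close>
  then have "det ?D = det (1\<^sub>m K - P)"
    using det_transpose[OF minus_carrier_mat[OF P], of "1\<^sub>m K"] by simp
  then have "det ?D \<noteq> 0"
    using det_one_minus_nonneg_mat[OF P nn assms(3)] by simp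
  \<comment> \<open>Both facts speak of units of the matrix ring; \<open>()\<close> fills the record
    extension of that ring.\<close>
  then have "mat_inverse ?D \<noteq> None"
    using mat_inverse(1)[OF D, of "()"] det_non_zero_imp_unit[OF D, of "()"] by blast
  then obtain C where C: "mat_inverse ?D = Some C" by blast
  have CD: "C * ?D = 1\<^sub>m K" and CC: "C \<in> carrier_mat K K"
    using mat_inverse(2)[OF D C] by auto
  have "C $$ (m, l) \<le> C $$ (m, m)" if m: "m < K" and l: "l < K" for m l
  proof (rule substochastic_potential_max[OF assms(2,3) _ m l, where x = "\<lambda>i. C $$ (m, i)"])
    fix i assume i: "i < K"
    \<comment> \<open>Since \<open>C\<close> multiplies from the left, entry \<open>(m, i)\<close>
      of the product involves row \<open>m\<close> of \<open>C\<close> and column \<open>i\<close>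
      of the transpose, that is, row \<open>i\<close> of \<open>P\<close>: this is the equation for
      \<open>x\<close>.\<close>
    have "C * ?D = C * 1\<^sub>m K - C * transpose_mat P"
      using mult_minus_distrib_mat[OF CC, of "1\<^sub>m K" K "transpose_mat P"] P by simp
    then have "(C - C * transpose_mat P) $$ (m, i) = 1\<^sub>m K $$ (m, i)"
      using CD CC by simp
    then show "C $$ (m, i) = (\<Sum>j<K. P $$ (i, j) * C $$ (m, j)) + (if i = m then 1 else 0)"
      using P CC i m
      by (auto simp: scalar_prod_def lessThan_atLeast0 mult.commute split: if_splits)
  qed
  then show ?thesis using C by blast
qed

end
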